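(* Let $a,d\ge2$ be integers and $k\in\mathbb Z$ with $h=|k-1|\ge2$. Define $$E_0=2a(d-1)+2,\qquad E_d=\begin{cases}5a(d-1)/2+2,&d\text{ odd},\\ a(5d-6)/2+3,&d\text{ even}.\end{cases}$$ The coefficients of $W_{a,d}(q,k)-T(q)$ below $q^{E_0}$ vanish. For $0\le r\le E_d-E_0$, $$h^{\,d-2-\lfloor r/a\rfloor-\lfloor(r-1)/a\rfloor}\ \bigm|\ [q^{E_0+r}]\bigl(W_{a,d}(q,k)-T(q)\bigr),$$ and the exponent of $h$ here is nonnegative. At the endpoint, with $b=-k(k-3)/2$, $$[q^{E_d}]\bigl(W_{a,d}(q,k)-T(q)\bigr)\equiv(-1)^{d-1}b^{\lfloor d/2\rfloor}\pmod h.$$ If $h\ge3$, this endpoint coefficient is nonzero modulo $h$, and therefore is the first nonzero coefficient of $W_{a,d}(q,k)-T(q)$ modulo $h$. More explicitly, $b\equiv1\pmod h$ if $h$ is odd, and $b\equiv1+h/2\pmod h$ if $h$ is even.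
   Context: $\Phi(q)=\prod_{n\ge1}(1-q^n)$; for every integer $k$ (possibly negative) $F(q)=\Phi(q)^k\in\mathbb Z[[q]]$. Define $C_m(q)\in\mathbb Z[[q]]$ by $$\frac{\sum_{m\ge0}X^mF(q^{am+1})}{\sum_{m\ge0}X^mF(q^{a(m+1)})}=\sum_{m\ge0}C_m(q)X^m\quad\text{in }\mathbb Z[[q]][[X]],$$ and the formal Laurent series in $q^{1-a}\mathbb Z[[q]]$ $$W_{a,d}(q,k)=q^{1-a}\sum_{j\ge0}C_{jd}(q)q^{ajd},\qquad T(q)=q^{1-a}\frac{\Phi(q)^k}{\Phi(q^a)^k}.$$ $[q^n]$ denotes the coefficient of $q^n$. Floors of negative numbers are the usual ones ($\lfloor-1/a\rfloor=-1$). *)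

theory Defs
  imports
    "HOL-Analysis.Infinite_Products"
    "HOL-Computational_Algebra.Formal_Laurent_Series"
    "HOL-Number_Theory.Cong"
begin

(* The coefficient ring is int, so the library's inverse, division and power_int on power
   series, which need a coefficient type of class inverse, are not available.
   unit_inverse is only ever applied to units. *)
definition unit_inverse :: "'a::comm_ring_1 \<Rightarrow> 'a" where
  "unit_inverse x = (THE y. x * y = 1)"

definition unit_power_int :: "'a::comm_ring_1 \<Rightarrow> int \<Rightarrow> 'a" where
  "unit_power_int x k = (if k \<ge> 0 then x ^ nat k else unit_inverse x ^ nat (- k))"

(* The infinite product is taken in the q-adic topology. *)
definition Euler_Phi :: "int fps" where
  "Euler_Phi = (\<Prod>n. 1 - fps_X ^ Suc n)"

definition F_series :: "int \<Rightarrow> int fps" where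
  "F_series k = unit_power_int Euler_Phi k"

(* In int fps fps, the inner variable is q and the outer variable is X. *)
definition C_num :: "nat \<Rightarrow> int \<Rightarrow> int fps fps" where
  "C_num a k = Abs_fps (\<lambda>m. F_series k oo fps_X ^ (a * m + 1))"

definition C_den :: "nat \<Rightarrow> int \<Rightarrow> int fps fps" where
  "C_den a k = Abs_fps (\<lambda>m. F_series k oo fps_X ^ (a * (m + 1)))"

definition C_series :: "nat \<Rightarrow> int \<Rightarrow> nat \<Rightarrow> int fps" where
  "C_series a k m = fps_nth (C_num a k * unit_inverse (C_den a k)) m"

definition W_series :: "nat \<Rightarrow> nat \<Rightarrow> int \<Rightarrow> int fls" where
  "W_series a d k = fls_X_intpow (1 - int a)
     * fps_to_fls (\<Sum>j. C_series a k (j * d) * fps_X ^ (a * j * d))"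

definition T_series :: "nat \<Rightarrow> int \<Rightarrow> int fls" where
  "T_series a k = fls_X_intpow (1 - int a)
     * fps_to_fls (unit_power_int Euler_Phi k
                   * unit_inverse (unit_power_int (Euler_Phi oo fps_X ^ a) k))"

definition E_start :: "nat \<Rightarrow> nat \<Rightarrow> int" where
  "E_start a d = 2 * int a * (int d - 1) + 2"

(* Both divisions by 2 are exact. *)
definition E_end :: "nat \<Rightarrow> nat \<Rightarrow> int" where
  "E_end a d = (if odd d then (5 * int a * (int d - 1)) div 2 + 2
                else (int a * (5 * int d - 6)) div 2 + 3)"

(* The following facts show that the inverses, the infinite product and the infinite sum
   above exist, so that none of the definitions takes an unspecified value. *)

lemma unit_inverse_eqI:
  assumes "x * y = 1"
  shows "unit_inverse x = y"
  unfolding unit_inverse_def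
proof (rule the_equality)
  show "x * y = 1" by (rule assms)
next
  fix z assume "x * z = 1"
  then have "y = (x * z) * y" by simp
  also have "\<dots> = (x * y) * z" by (simp add: ac_simps)
  finally show "z = y" using assms by simp
qed

lemma fps_mult_unit_inverse:
  fixes f :: "'a::comm_ring_1 fps"
  assumes "fps_nth f 0 * y = 1"
  shows "f * unit_inverse f = 1"
  using fps_right_inverse[OF assms] unit_inverse_eqI[OF fps_right_inverse[OF assms]] by (simp only:)

lemma has_prod_Euler_Phi: "(\<lambda>n. 1 - fps_X ^ Suc n) has_prod Euler_Phi"
  and Euler_Phi_nth_0: "fps_nth Euler_Phi 0 = 1"
proof -
  define P :: "nat \<Rightarrow> int fps" where "P n = (\<Prod>i\<le>n. 1 - fps_X ^ Suc i)" for n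
  define p where "p = Abs_fps (\<lambda>m. fps_nth (P m) m)"
  have stable: "fps_nth (P n) m = fps_nth (P m) m" if "m \<le> n" for m n
    using that
  proof (induction n rule: dec_induct)
    case base
    then show ?case by simp
  next
    case (step n)
    have "P (Suc n) = P n - P n * fps_X ^ Suc (Suc n)"
      by (simp only: P_def prod.atMost_Suc right_diff_distrib mult_1_right)
    then have "fps_nth (P (Suc n)) m = fps_nth (P n) m"
      using step.hyps by (simp add: fps_X_power_mult_right_nth del: power_Suc)
    then show ?case using step.IH by simp
  qed
  have "P \<longlonglongrightarrow> p"
  proof (rule tendsto_fpsI)
    fix m
    show "eventually (\<lambda>n. fps_nth (P n) m = fps_nth p m) sequentially"
      using eventually_ge_at_top[of m] by eventually_elim (unfold p_def fps_nth_Abs_fps, rule stable)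
  qed
  moreover have p0: "fps_nth p 0 = 1" by (simp add: p_def P_def)
  moreover have "p \<noteq> 0" using p0 by auto
  ultimately have "(\<lambda>n. 1 - fps_X ^ Suc n) has_prod p"
    by (simp add: has_prod_def raw_has_prod_def P_def [abs_def] del: power_Suc)
  moreover from this have "Euler_Phi = p"
    unfolding Euler_Phi_def by (rule has_prod_unique[symmetric])
  ultimately show "(\<lambda>n. 1 - fps_X ^ Suc n) has_prod Euler_Phi" "fps_nth Euler_Phi 0 = 1"
    using p0 by simp_all
qed

lemma unit_power_int_nth_0:
  fixes f :: "int fps"
  assumes "fps_nth f 0 = 1"
  shows "fps_nth (unit_power_int f k) 0 = 1"
proof -
  have "f * unit_inverse f = 1"
    by (rule fps_mult_unit_inverse[of _ 1]) (simp add: assms)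
  then have "fps_nth (f * unit_inverse f) 0 = 1" by simp
  then have "fps_nth (unit_inverse f) 0 = 1" by (simp add: assms)
  then show ?thesis by (simp add: unit_power_int_def assms fps_nth_power_0)
qed

lemma C_series_mult_C_den:
  shows "Abs_fps (C_series a k) * C_den a k = C_num a k"
proof -
  have "fps_nth (C_den a k) 0 * unit_inverse (fps_nth (C_den a k) 0) = 1"
    by (rule fps_mult_unit_inverse[of _ 1])
       (simp add: C_den_def F_series_def unit_power_int_nth_0 Euler_Phi_nth_0)
  then have "C_den a k * unit_inverse (C_den a k) = 1"
    by (rule fps_mult_unit_inverse)
  moreover have "Abs_fps (C_series a k) = C_num a k * unit_inverse (C_den a k)"
    by (simp add: fps_eq_iff C_series_def)
  ultimately show ?thesis by (simp only: mult.assoc mult.commute[of "unit_inverse _"] mult_1_right)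
qed

lemma T_series_den_inverse:
  "unit_power_int (Euler_Phi oo fps_X ^ a) k
     * unit_inverse (unit_power_int (Euler_Phi oo fps_X ^ a) k) = 1"
  by (rule fps_mult_unit_inverse[of _ 1]) (simp add: unit_power_int_nth_0 Euler_Phi_nth_0)

lemma summable_W_series:
  assumes "a > 0" "d > 0"
  shows "summable (\<lambda>j. C_series a k (j * d) * fps_X ^ (a * j * d))"
proof -
  let ?f = "\<lambda>j. C_series a k (j * d) * fps_X ^ (a * j * d)"
  define s where "s = Abs_fps (\<lambda>m. fps_nth (\<Sum>j<Suc m. ?f j) m)"
  have zero: "fps_nth (?f j) m = 0" if "m < j" for j m
  proof -
    have "j * 1 \<le> j * (a * d)" using assms by (intro mult_le_mono2) (simp add: Suc_le_eq)
    also have "\<dots> = a * j * d" by (simp only: ac_simps)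
    finally have "m < a * j * d" using that by linarith
    then show ?thesis by (simp add: fps_X_power_mult_right_nth)
  qed
  have "(\<lambda>n. \<Sum>j<n. ?f j) \<longlonglongrightarrow> s"
  proof (rule tendsto_fpsI)
    fix m
    have "fps_nth (\<Sum>j<n. ?f j) m = fps_nth s m" if "n \<ge> Suc m" for n
      using that
    proof (induction n rule: dec_induct)
      case base
      then show ?case by (simp add: s_def)
    next
      case (step n)
      then show ?case using zero[of m n] by simp
    qed
    then show "eventually (\<lambda>n. fps_nth (\<Sum>j<n. ?f j) m = fps_nth s m) sequentially"
      unfolding eventually_sequentially by blast
  qed
  then show ?thesis by (auto simp: summable_def sums_def)
qed

end

(*
  Write x = q^a, N(X) and D(X) for the numerator and denominator series, and F = 1 - kq + q^2 H.
  Multiplying both by (1 - X)(1 - xX) kills the contributions of 1 and q to F in all but the first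
  two coefficients.  After rescaling X to Y = xX the denominator becomes
  1 + (k - 1) Y - b x Y^2 + ..., and the omitted terms x^s Y^m all have 2s > m.  So in the quotient
  each factor x pays for two factors Y, and every Y that is not paid for costs a factor k - 1; this
  gives the divisibility.  On the extremal line only the recursion factor b x Y^2 survives modulo h,
  which gives the powers of b.
*)

theory Submission
  imports Defs
begin

section \<open>Powers of Phi up to order q^2\<close>

lemma Euler_Phi_nth_1: "fps_nth Euler_Phi 1 = -1"
  and Euler_Phi_nth_2: "fps_nth Euler_Phi 2 = -1"
proof -
  define P :: "nat \<Rightarrow> int fps" where "P n = (\<Prod>i\<le>n. 1 - fps_X ^ Suc i)" for n
  have "P \<longlonglongrightarrow> Euler_Phi"
    using has_prod_imp_tendsto[OF has_prod_Euler_Phi] by (simp only: P_def [abs_def])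
  then have lim: "eventually (\<lambda>n. fps_nth (P n) m = fps_nth Euler_Phi m) sequentially" for m
    by (simp add: tendsto_fps_iff)
  \<comment> \<open>From \<open>n = 1\<close> on, every further factor is 1 - q^j with j at least 3,
    so the coefficients in degrees 1 and 2 have settled.\<close>
  have P: "fps_nth (P n) 1 = -1 \<and> fps_nth (P n) 2 = -1" if "n \<ge> 1" for n
    using that
  proof (induction n rule: dec_induct)
    case base
    have "P 1 = 1 - fps_X - fps_X ^ 2 + fps_X ^ 3"
      by (simp add: P_def atMost_Suc algebra_simps power2_eq_square power3_eq_cube)
    then show ?case by simp
  next
    case (step n)
    have "P (Suc n) = P n - P n * fps_X ^ Suc (Suc n)"
      by (simp only: P_def prod.atMost_Suc right_diff_distrib mult_1_right)
    then show ?case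
      using step by (simp add: fps_X_power_mult_right_nth del: power_Suc)
  qed
  have "fps_nth Euler_Phi m = -1" if "m = 1 \<or> m = 2" for m
  proof -
    obtain N where "\<forall>n\<ge>N. fps_nth (P n) m = fps_nth Euler_Phi m"
      using lim[of m] unfolding eventually_sequentially ..
    then have "fps_nth (P (Suc N)) m = fps_nth Euler_Phi m" by simp
    then show ?thesis using P[of "Suc N"] that by auto
  qed
  then show "fps_nth Euler_Phi 1 = -1" "fps_nth Euler_Phi 2 = -1" by auto
qed

lemma fps_mult_nth_2:
  "fps_nth (f * g) 2 = fps_nth f 0 * fps_nth g 2 + fps_nth f 1 * fps_nth g 1 + fps_nth f 2 * fps_nth g 0"
  by (simp add: fps_mult_nth numeral_2_eq_2)

text \<open>The jet of order 2 of Phi^k. The last equation is doubled to avoid division in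
  \<open>int\<close>. Products add the exponents k, which carries the jet from Phi to all integer
  powers.\<close>

definition Phi_jet :: "int \<Rightarrow> int fps \<Rightarrow> bool" where
  "Phi_jet k f \<longleftrightarrow> fps_nth f 0 = 1 \<and> fps_nth f 1 = - k \<and> 2 * fps_nth f 2 = k * (k - 3)"

lemma Phi_jet_mult: "Phi_jet k f \<Longrightarrow> Phi_jet l g \<Longrightarrow> Phi_jet (k + l) (f * g)"
  unfolding Phi_jet_def fps_mult_nth_2 fps_mult_nth_1 fps_mult_nth_0
  by (auto simp: algebra_simps)

lemma Phi_jet_power: "Phi_jet k f \<Longrightarrow> Phi_jet (int n * k) (f ^ n)"
proof (induction n)
  case 0
  then show ?case by (simp add: Phi_jet_def)
next
  case (Suc n)
  then show ?case using Phi_jet_mult[of k f "int n * k" "f ^ n"] by (simp add: algebra_simps)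
qed

lemma Phi_jet_inverse:
  assumes "Phi_jet k f" "f * g = 1"
  shows "Phi_jet (- k) g"
proof -
  have 0: "fps_nth g 0 = 1" using arg_cong[OF assms(2), of "\<lambda>u. fps_nth u 0"] assms(1)
    by (simp add: Phi_jet_def)
  have 1: "fps_nth g 1 = k" using arg_cong[OF assms(2), of "\<lambda>u. fps_nth u 1"] assms(1) 0
    by (simp add: Phi_jet_def)
  have "fps_nth g 2 = k * k - fps_nth f 2"
    using arg_cong[OF assms(2), of "\<lambda>u. fps_nth u 2"] assms(1) 0 1
    by (simp add: Phi_jet_def fps_mult_nth_2)
  then show ?thesis using 0 1 assms(1) by (simp add: Phi_jet_def algebra_simps)
qed

lemma Phi_jet_F_series: "Phi_jet k (F_series k)"
proof -
  have Phi: "Phi_jet 1 Euler_Phi"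
    using Euler_Phi_nth_1 by (simp add: Phi_jet_def Euler_Phi_nth_0 Euler_Phi_nth_2)
  have "Euler_Phi * unit_inverse Euler_Phi = 1"
    by (rule fps_mult_unit_inverse[of _ 1]) (simp add: Euler_Phi_nth_0)
  note inv = Phi_jet_inverse[OF Phi this]
  show ?thesis
    using Phi_jet_power[OF Phi, of "nat k"] Phi_jet_power[OF inv, of "nat (- k)"]
    by (cases "k \<ge> 0") (simp_all add: F_series_def unit_power_int_def)
qed

section \<open>Splitting off the quadratic tail of F\<close>

text \<open>This is H(q^p), where F = 1 - kq + q^2 H.\<close>

abbreviation F_tail :: "int \<Rightarrow> nat \<Rightarrow> int fps" where
  "F_tail k p \<equiv> fps_shift 2 (F_series k) oo fps_X ^ p"

lemma F_series_compose:
  assumes "p > 0"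
  shows "F_series k oo fps_X ^ p = 1 - fps_const k * fps_X ^ p + (fps_X ^ p) ^ 2 * F_tail k p"
proof -
  have "F_series k = 1 - fps_const k * fps_X + fps_X ^ 2 * fps_shift 2 (F_series k)"
    (is "_ = ?R")
  proof (rule fps_ext)
    fix n :: nat
    consider "n = 0" | "n = 1" | m where "n = Suc (Suc m)"
      by (metis One_nat_def not0_implies_Suc)
    then show "fps_nth (F_series k) n = fps_nth ?R n"
      using Phi_jet_F_series[of k] by cases (auto simp: Phi_jet_def fps_X_power_mult_nth)
  qed
  then have "F_series k oo fps_X ^ p = ?R oo fps_X ^ p" by (rule arg_cong)
  also have "\<dots> = 1 - fps_const k * fps_X ^ p + (fps_X ^ p) ^ 2 * F_tail k p"
    using assms by (simp add: fps_compose_add_distrib fps_compose_sub_distrib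
        fps_compose_mult_distrib fps_compose_power [symmetric])
  finally show ?thesis .
qed

lemma F_tail_nth_0: "2 * fps_nth (F_tail k p) 0 = k * (k - 3)"
  using Phi_jet_F_series[of k] by (simp add: Phi_jet_def fps_nth_compose_X_power numeral_2_eq_2)

lemma F_tail_nth_less: "0 < n \<Longrightarrow> n < p \<Longrightarrow> fps_nth (F_tail k p) n = 0"
  by (auto simp: fps_nth_compose_X_power dest: nat_dvd_not_less)

section \<open>Second differences of numerator and denominator\<close>

text \<open>The factor is (1 - X)(1 - xX). Its recurrence has the characteristic roots 1 and x, so
  from index 2 on it annihilates every sequence alpha + beta x^m. Such sequences are what the part 1
  - kq of F contributes to \<open>C_num\<close> and \<open>C_den\<close>.\<close>

definition second_diff :: "int fps \<Rightarrow> int fps fps \<Rightarrow> int fps fps" where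
  "second_diff x g = (1 - fps_const (1 + x) * fps_X + fps_const x * fps_X ^ 2) * g"

lemma second_diff_nth:
  "fps_nth (second_diff x g) 0 = fps_nth g 0"
  "fps_nth (second_diff x g) (Suc 0) = fps_nth g 1 - (1 + x) * fps_nth g 0"
  "fps_nth (second_diff x g) (Suc (Suc m)) = fps_nth g (m + 2) - (1 + x) * fps_nth g (m + 1) + x * fps_nth g m"
proof -
  have *: "second_diff x g = g - fps_const (1 + x) * (fps_X * g) + fps_const x * (fps_X ^ 2 * g)"
    by (simp only: second_diff_def algebra_simps mult_1_left)
  show "fps_nth (second_diff x g) 0 = fps_nth g 0"
    "fps_nth (second_diff x g) (Suc 0) = fps_nth g 1 - (1 + x) * fps_nth g 0"
    "fps_nth (second_diff x g) (Suc (Suc m)) = fps_nth g (m + 2) - (1 + x) * fps_nth g (m + 1) + x * fps_nth g m"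
    unfolding * by (simp_all add: fps_X_power_mult_nth del: fps_const_add fps_const_1_eq_1)
qed

lemma den_second_diff_0:
  assumes "a > 0"
  shows "fps_nth (fps_nth (second_diff (fps_X ^ a) (C_den a k)) 0) 0 = 1"
    and "0 < t \<Longrightarrow> t < a \<Longrightarrow> fps_nth (fps_nth (second_diff (fps_X ^ a) (C_den a k)) 0) t = 0"
  using assms Phi_jet_F_series[of k]
  by (auto simp: second_diff_nth C_den_def fps_nth_compose_X_power Phi_jet_def dest: nat_dvd_not_less)

text \<open>This is where k - 1 enters: -x from 1 - (1 + x) and kx from the linear part of F
  combine, the two terms k x^2 cancel, and the tails start at x^2.\<close>

lemma den_second_diff_1:
  assumes "a > 0" "t < 2 * a"
  shows "fps_nth (fps_nth (second_diff (fps_X ^ a) (C_den a k)) 1) t = (if t = a then k - 1 else 0)"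
proof -
  define x :: "int fps" where "x = fps_X ^ a"
  have p: "fps_X ^ (2 * a) = x ^ 2"
    by (simp add: x_def mult.commute[of 2] power_mult)
  have "fps_nth (second_diff x (C_den a k)) 1
      = (F_series k oo fps_X ^ (2 * a)) - (1 + x) * (F_series k oo fps_X ^ a)"
    by (simp add: second_diff_nth C_den_def mult_2)
  moreover have "F_series k oo fps_X ^ (2 * a) = 1 - fps_const k * x ^ 2 + (x ^ 2) ^ 2 * F_tail k (2 * a)"
    using F_series_compose[of "2 * a" k] assms(1) by (simp add: p)
  moreover have "F_series k oo fps_X ^ a = 1 - fps_const k * x + x ^ 2 * F_tail k a"
    using F_series_compose[of a k] assms(1) by (simp add: x_def)
  \<comment> \<open>Splitting the constant makes \<open>fps_const k\<close> the only atom containing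
    k, so that a polynomial identity remains.\<close>
  moreover have "fps_const (k - 1) = fps_const k - 1"
    by (simp flip: fps_const_sub)
  ultimately have "fps_nth (second_diff x (C_den a k)) 1
    = fps_const (k - 1) * x + x ^ 2 * (x ^ 2 * F_tail k (2 * a) - (1 + x) * F_tail k a)"
    by algebra
  then show ?thesis
    using assms unfolding p [symmetric]
    by (simp add: x_def fps_X_power_mult_nth)
qed

text \<open>Only the tails survive, and the lowest of them carries x * x^(2(m+1)). In terms of Y =
  xX the coefficient of Y^(m+2) therefore starts at x^(m+1).\<close>

lemma den_second_diff_ge_2:
  assumes "a > 0"
  shows "fps_nth (second_diff (fps_X ^ a) (C_den a k)) (m + 2) = fps_X ^ (a * (2 * m + 3)) *
    (fps_X ^ (3 * a) * F_tail k (a * (m + 3)) - (1 + fps_X ^ a) * fps_X ^ a * F_tail k (a * (m + 2))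
      + F_tail k (a * (m + 1)))"
proof -
  define x :: "int fps" where "x = fps_X ^ a"
  \<comment> \<open>Naming the symbolic power x^m turns the claim into a polynomial identity in x, y
    and the tails.\<close>
  define y where "y = x ^ m"
  have p: "fps_X ^ (a * n) = x ^ n" for n by (simp add: x_def power_mult)
  have F: "F_series k oo fps_X ^ (a * n)
      = 1 - fps_const k * x ^ n + (x ^ n) ^ 2 * F_tail k (a * n)" if "n > 0" for n
    using F_series_compose[of "a * n" k] assms that by (simp add: p)
  have "fps_nth (second_diff x (C_den a k)) (m + 2) =
     (F_series k oo fps_X ^ (a * (m + 3))) - (1 + x) * (F_series k oo fps_X ^ (a * (m + 2)))
      + x * (F_series k oo fps_X ^ (a * (m + 1)))"
    by (simp add: second_diff_nth C_den_def numeral_3_eq_3 numeral_2_eq_2)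
  also have "\<dots> = y ^ 2 * x ^ 3 * (x ^ 3 * F_tail k (a * (m + 3)) - (1 + x) * x * F_tail k (a * (m + 2))
      + F_tail k (a * (m + 1)))"
    by (simp only: F add_pos_pos zero_less_numeral zero_less_one add_nonneg_pos le0
        power_add power_one_right flip: y_def) algebra
  finally show ?thesis
    by (simp only: p mult.commute[of _ a] x_def [symmetric] y_def power_add power_mult mult.commute[of _ m])
qed

text \<open>The assumption a >= 2 keeps q^a out of degrees 0 and 1. The value k starts the chain of
  extremal coefficients for odd d.\<close>

lemma num_second_diff_1:
  assumes "a \<ge> 2"
  shows "fps_nth (fps_nth (second_diff (fps_X ^ a) (C_num a k)) 1) 0 = 0"
    "fps_nth (fps_nth (second_diff (fps_X ^ a) (C_num a k)) 1) 1 = k"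
proof -
  define G where "G = fps_nth (second_diff (fps_X ^ a) (C_num a k)) 1"
  have "G = (F_series k oo fps_X ^ (a + 1)) - (F_series k oo fps_X) - fps_X ^ a * (F_series k oo fps_X)"
    by (simp add: G_def second_diff_nth C_num_def algebra_simps)
  then show "fps_nth G 0 = 0" "fps_nth G 1 = k"
    using assms Phi_jet_F_series[of k]
    by (auto simp: fps_X_power_mult_nth fps_nth_compose_X_power Phi_jet_def simp del: power_Suc)
qed

text \<open>The constant and linear parts cancel because 1 - (1 + x) + x and x^2 - (1 + x) x + x
  both vanish.\<close>

lemma second_diff_identity:
  fixes x y q c G0 G1 G2 :: "'a::comm_ring_1"
  shows "(1 - c * (y * x ^ 2 * q) + (y * x ^ 2 * q) ^ 2 * G2)
      - (1 + x) * (1 - c * (y * x * q) + (y * x * q) ^ 2 * G1)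
      + x * (1 - c * (y * q) + (y * q) ^ 2 * G0)
    = y ^ 2 * x * q ^ 2 * (x ^ 3 * G2 - (1 + x) * x * G1 + G0)"
  by (simp add: algebra_simps power2_eq_square power3_eq_cube)

text \<open>As for the denominator, only the tails survive; here the lowest carries x (x^m
  q)^2.\<close>

lemma num_second_diff_ge_2:
  assumes "a > 0"
  shows "fps_nth (second_diff (fps_X ^ a) (C_num a k)) (m + 2) = fps_X ^ (a * (2 * m + 1) + 2) *
    (fps_X ^ (3 * a) * F_tail k (a * (m + 2) + 1) - (1 + fps_X ^ a) * fps_X ^ a * F_tail k (a * (m + 1) + 1)
      + F_tail k (a * m + 1))"
proof -
  define x :: "int fps" where "x = fps_X ^ a"
  define y where "y = x ^ m"
  have p: "fps_X ^ (a * n) = x ^ n" for n by (simp add: x_def power_mult)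
  have F: "F_series k oo fps_X ^ (a * n + 1)
      = 1 - fps_const k * (x ^ n * fps_X) + (x ^ n * fps_X) ^ 2 * F_tail k (a * n + 1)" for n
    using F_series_compose[of "a * n + 1" k] assms by (simp only: p power_add power_one_right)
  have e: "x ^ (m + 2) = y * x ^ 2" "x ^ (m + 1) = y * x" by (simp_all add: y_def power_add power2_eq_square)
  have "fps_nth (second_diff x (C_num a k)) (m + 2) =
     (F_series k oo fps_X ^ (a * (m + 2) + 1)) - (1 + x) * (F_series k oo fps_X ^ (a * (m + 1) + 1))
      + x * (F_series k oo fps_X ^ (a * m + 1))"
    by (simp add: second_diff_nth C_num_def numeral_3_eq_3 numeral_2_eq_2)
  also have "\<dots> = y ^ 2 * x * fps_X ^ 2 * (x ^ 3 * F_tail k (a * (m + 2) + 1)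
      - (1 + x) * x * F_tail k (a * (m + 1) + 1) + F_tail k (a * m + 1))"
    by (simp only: F e second_diff_identity flip: y_def)
  also have "y ^ 2 * x = fps_X ^ (a * (2 * m + 1))"
    by (simp add: x_def y_def distrib_left ac_simps flip: power_mult power_add)
  also have "x ^ 3 = fps_X ^ (3 * a)"
    by (simp add: x_def ac_simps flip: power_mult)
  finally show ?thesis by (simp only: x_def power_add)
qed

section \<open>The floor sum in the exponent of h\<close>

text \<open>The number of factors Y that a remaining power q^r can pay for; the exponent of h in the
  theorem is d minus this number. For a >= 2 it is 1 at r = 0 and 2 at r = 1, and then grows by one
  at each multiple of a and at the successor of each multiple.\<close>

definition weight :: "int \<Rightarrow> int \<Rightarrow> int" where
  "weight a r = r div a + (r - 1) div a + 2"

lemma mult_div_bounds: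
  fixes a x :: int
  assumes "a > 0"
  shows "a * (x div a) \<le> x" "x < a * (x div a + 1)"
proof -
  have "x = a * (x div a) + x mod a" by simp
  then show "a * (x div a) \<le> x" "x < a * (x div a + 1)"
    using assms pos_mod_sign[OF assms, of x] pos_mod_bound[OF assms, of x]
    unfolding distrib_left by linarith+
qed

lemma div_add_le:
  fixes a x y :: int
  assumes "a > 0"
  shows "x div a + y div a \<le> (x + y) div a"
proof -
  have "(x mod a + y mod a) div a \<ge> 0"
    using assms by (simp add: pos_imp_zdiv_nonneg_iff)
  then show ?thesis by (simp add: div_add1_eq[of x y a])
qed

text \<open>Superadditivity of the floor, applied to both summands: every whole power of x in q^s
  pays for two more factors Y.\<close>

lemma weight_add_le:
  assumes "a > 0"
  shows "weight a r + 2 * (s div a) \<le> weight a (r + s)"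
  using div_add_le[OF assms, of r s] div_add_le[OF assms, of "r - 1" s]
  by (simp add: weight_def algebra_simps)

lemma weight_mono: "a > 0 \<Longrightarrow> r \<le> s \<Longrightarrow> weight a r \<le> weight a s"
  unfolding weight_def by (intro add_mono zdiv_mono1) auto

lemma weight_multiple: "a \<ge> 2 \<Longrightarrow> weight a (a * n) = 2 * n + 1"
proof -
  assume a: "a \<ge> 2"
  have "(a * n - 1) div a = n + (-1) div a"
    using a div_mult_self4[of a n "- 1"] by (simp add: algebra_simps)
  also have "(-1) div a = -1" using a by (simp add: div_eq_minus1)
  finally show ?thesis using a by (simp add: weight_def)
qed

lemma weight_multiple_add_1: "a \<ge> 2 \<Longrightarrow> weight a (a * n + 1) = 2 * n + 2"
  by (simp add: weight_def)

lemma weight_multiple_minus_1: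
  assumes "a \<ge> 2"
  shows "weight a (a * n - 1) = 2 * n"
proof -
  have "(a * n - i) div a = n - 1" if "0 < i" "i \<le> a" for i
    using that by (intro int_div_pos_eq[of _ _ _ "a - i"]) (auto simp: algebra_simps)
  then show ?thesis using assms by (simp add: weight_def)
qed

text \<open>Clipping at 0 by \<open>nat\<close> respects the bound on l, so negative exponents need
  no case distinction in the induction on the quotient.\<close>

lemma power_dvd_mult_nat:
  fixes h :: int
  assumes "h ^ nat i dvd x" "h ^ nat j dvd y" "l \<le> i + j"
  shows "h ^ nat l dvd x * y"
proof -
  have "h ^ nat l dvd h ^ (nat i + nat j)" using assms(3) by (intro le_imp_power_dvd) linarith
  also have "\<dots> dvd x * y" unfolding power_add by (intro mult_dvd_mono assms)
  finally show ?thesis .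
qed

section \<open>Divisibility of the coefficients of an abstract quotient\<close>

text \<open>Here \<open>A\<close>, \<open>B\<close> and \<open>c\<close> hold the coefficients of
  X^m q^t in numerator, denominator and quotient, the first two after second differencing. The
  bounds say where each coefficient starts; \<open>f\<close> is the coefficient of x Y^2 = x^3 X^2
  in the denominator, which will be -b.\<close>

locale graded_quotient =
  fixes a :: nat and h k f :: int and A B c :: "nat \<Rightarrow> nat \<Rightarrow> int"
  assumes a: "a \<ge> 2"
    and conv: "(\<Sum>i\<le>m. \<Sum>s\<le>t. B i s * c (m - i) (t - s)) = A m t"
    and B_0_0: "B 0 0 = 1"
    and B_0: "0 < s \<Longrightarrow> s < a \<Longrightarrow> B 0 s = 0"
    and B_1: "s < 2 * a \<Longrightarrow> h dvd B 1 s"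
    and B_1_less: "s < a \<Longrightarrow> B 1 s = 0"
    and B_ge_2: "i \<ge> 2 \<Longrightarrow> s < a * (2 * i - 1) \<Longrightarrow> B i s = 0"
    and B_2: "3 * a \<le> s \<Longrightarrow> s < 4 * a \<Longrightarrow> B 2 s = (if s = 3 * a then f else 0)"
    and A_1: "A 1 0 = 0" "A 1 1 = k"
    and A_ge_2: "m \<ge> 2 \<Longrightarrow> t < a * (2 * m - 3) + 2 \<Longrightarrow> A m t = 0"
    and A_2: "A 2 (a + 2) = f"
begin

text \<open>The power of $q$ that remains when the $m$-th coefficient of the quotient is divided by
  $q^{1-a} x^m$, the factor introduced by the rescaling $Y = xX$.\<close>

definition excess :: "nat \<Rightarrow> nat \<Rightarrow> int" where
  "excess m t = int t - int a * (int m - 1) - 1"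

lemma B_eq_0:
  assumes "i \<ge> 2" "(int s - int a * int i) div int a + 2 \<le> int i"
  shows "B i s = 0"
proof -
  let ?u = "(int s - int a * int i) div int a"
  have "int s - int a * int i < int a * (?u + 1)"
    using a by (intro mult_div_bounds) simp
  also have "\<dots> \<le> int a * (int i - 1)" using assms(2) by (intro mult_left_mono) auto
  finally have "int s < int a * (2 * int i - 1)" by (simp add: algebra_simps)
  also have "\<dots> = int (a * (2 * i - 1))" using assms(1) by (simp add: of_nat_diff)
  finally show ?thesis using assms(1) by (intro B_ge_2) linarith+
qed

lemma B_less: "s < a * i \<Longrightarrow> B i s = 0"
proof -
  assume s: "s < a * i"
  consider "i = 0" | "i = 1" | "i \<ge> 2" by linarith
  then show ?thesis
  proof cases
    case 3
    have "a * i \<le> a * (2 * i - 1)" using 3 by (intro mult_le_mono2) linarith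
    then show ?thesis using 3 s by (intro B_ge_2) linarith+
  qed (use s B_1_less in auto)
qed

text \<open>With u whole powers of x beside Y^i, at least i - 2u factors h are due. For i = 0 none
  are. For i = 1 one is due only if u <= 0, where \<open>B_1\<close> or \<open>B_1_less\<close>
  applies. For i >= 2 a nonzero coefficient has u >= i - 1, hence i <= 2u.\<close>

lemma B_dvd: "h ^ nat (int i - 2 * ((int s - int a * int i) div int a)) dvd B i s"
proof -
  let ?u = "(int s - int a * int i) div int a"
  consider "i = 0" | "i = 1" "s < a" | "i = 1" "a \<le> s" "s < 2 * a" | "i = 1" "2 * a \<le> s"
    | "i \<ge> 2" "?u + 2 \<le> int i" | "i \<ge> 2" "\<not> ?u + 2 \<le> int i" by linarith
  then show ?thesis
  proof cases
    case 1
    then have "nat (int i - 2 * ?u) = 0" using a by (simp add: div_int_pos_iff)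
    then show ?thesis by (metis one_dvd power_0)
  next
    case 2
    then show ?thesis by (simp add: B_1_less [simplified])
  next
    case 3
    then have "?u = 0" by (intro div_pos_pos_trivial) auto
    then show ?thesis using 3 B_1 by simp
  next
    case 4
    have "int a * 1 div int a \<le> ?u" using 4 a by (intro zdiv_mono1) auto
    then show ?thesis using 4 a by simp
  next
    case 5
    then show ?thesis by (simp add: B_eq_0)
  next
    case 6
    then have "int i - 2 * ?u \<le> 0" by linarith
    then show ?thesis by simp
  qed
qed

text \<open>These are the terms whose powers of x pay exactly for their Y. For i >= 4 the balance i
  = 2u gives u < i - 1, where the coefficient vanishes; this leaves i = 0 and i = 2, u = 1.\<close>

lemma B_extremal:
  assumes "int i = 2 * ((int s - int a * int i) div int a)"
  shows "B i s = (if i = 0 \<and> s = 0 then 1 else if i = 2 \<and> s = 3 * a then f else 0)"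
proof -
  let ?u = "(int s - int a * int i) div int a"
  have lo: "int a * ?u \<le> int s - int a * int i"
    and hi: "int s - int a * int i < int a * (?u + 1)"
    using a by (intro mult_div_bounds; simp)+
  have "even i" using assms by (metis dvd_triv_left even_of_nat)
  then have "i = 0 \<or> i = 2 \<or> i \<ge> 4" by presburger
  then consider "i = 0" | "i = 2" | "i \<ge> 4" by blast
  then show ?thesis
  proof cases
    case 1
    then have "s < a" using hi assms by simp
    then show ?thesis using 1 B_0_0 B_0 by auto
  next
    case 2
    then have u: "?u = 1" using assms by simp
    have "3 * a \<le> s" "s < 4 * a" using lo hi unfolding u unfolding 2 by auto
    then show ?thesis using 2 B_2 by auto
  next
    case 3
    then show ?thesis using assms by (subst B_eq_0) auto
  qed
qed

text \<open>The numerator never owes a factor h. The last bound exceeds m once m >= 3, which keeps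
  those terms off the extremal line.\<close>

lemma A_excess:
  assumes "A m t \<noteq> 0"
  shows "excess m t \<ge> 0" "weight (int a) (excess m t) \<ge> int m"
    "m \<ge> 2 \<Longrightarrow> weight (int a) (excess m t) \<ge> 2 * int m - 2"
proof -
  have *: "excess m t \<ge> int a * (int m - 2) + 1" if "m \<ge> 2"
  proof -
    have "\<not> t < a * (2 * m - 3) + 2" using A_ge_2[OF that] assms by blast
    moreover have "int (a * (2 * m - 3)) = int a * (2 * int m - 3)" using that by (simp add: of_nat_diff)
    ultimately show ?thesis by (simp add: excess_def algebra_simps)
  qed
  have w: "weight (int a) (excess m t) \<ge> 2 * int m - 2" if "m \<ge> 2"
    using weight_mono[OF _ *[OF that], of "int a"] weight_multiple_add_1[of "int a" "int m - 2"] a by simp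
  consider "m = 0" | "m = 1" "t > 0" | "m \<ge> 2" using A_1 assms by (metis One_nat_def gr0I less_2_cases not_less)
  then have "excess m t \<ge> 0 \<and> weight (int a) (excess m t) \<ge> int m"
  proof cases
    case 1
    then have "excess m t \<ge> 0" using a by (simp add: excess_def)
    then show ?thesis using weight_mono[of "int a" 0] weight_multiple[of "int a" 0] a 1 by fastforce
  next
    case 2
    then have "excess m t \<ge> 0" by (simp add: excess_def)
    then show ?thesis using weight_mono[of "int a" 0] weight_multiple[of "int a" 0] a 2 by fastforce
  next
    case 3
    have "0 \<le> int a * (int m - 2)" using 3 by simp
    then show ?thesis using *[OF 3] w[OF 3] 3 by linarith
  qed
  then show "excess m t \<ge> 0" "weight (int a) (excess m t) \<ge> int m" by auto
  show "m \<ge> 2 \<Longrightarrow> weight (int a) (excess m t) \<ge> 2 * int m - 2" by (rule w)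
qed

lemma excess_split:
  assumes "i \<le> m" "s \<le> t"
  shows "excess m t = excess (m - i) (t - s) + (int s - int a * int i)"
  using assms by (simp add: excess_def of_nat_diff algebra_simps)

lemma c_eq:
  "c m t = A m t - (\<Sum>(i, s) \<in> {..m} \<times> {..t} - {(0, 0)}. B i s * c (m - i) (t - s))"
proof -
  have "A m t = (\<Sum>(i, s) \<in> {..m} \<times> {..t}. B i s * c (m - i) (t - s))"
    by (simp add: conv [symmetric] sum.cartesian_product)
  also have "\<dots> = B 0 0 * c m t + (\<Sum>(i, s) \<in> {..m} \<times> {..t} - {(0, 0)}. B i s * c (m - i) (t - s))"
    by (subst sum.remove[of _ "(0, 0)"]) auto
  finally show ?thesis by (simp add: B_0_0)
qed

text \<open>Induction on m + t along the recursion \<open>c_eq\<close>: \<open>excess\<close> is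
  additive, so the debt i - 2u of the denominator and the debt of the smaller quotient coefficient
  add up to at least the debt claimed.\<close>

lemma c_excess:
  "(excess m t < 0 \<longrightarrow> c m t = 0) \<and> h ^ nat (int m - weight (int a) (excess m t)) dvd c m t"
proof (induction "m + t" arbitrary: m t rule: less_induct)
  case less
  have summand: "(excess m t < 0 \<longrightarrow> B i s * c (m - i) (t - s) = 0) \<and>
      h ^ nat (int m - weight (int a) (excess m t)) dvd B i s * c (m - i) (t - s)"
    if le: "i \<le> m" "s \<le> t" "(i, s) \<noteq> (0, 0)" for i s
  proof -
    let ?e = "excess (m - i) (t - s)" and ?s = "int s - int a * int i"
    have IH: "(?e < 0 \<longrightarrow> c (m - i) (t - s) = 0) \<and>
        h ^ nat (int (m - i) - weight (int a) ?e) dvd c (m - i) (t - s)"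
      by (rule less) (use le in auto)
    have e: "excess m t = ?e + ?s" by (rule excess_split) fact+
    \<comment> \<open>Negative excess of the product forces a negative share in one factor: either s
      < ai and \<open>B i s\<close> vanishes, or the induction hypothesis applies to the other
      factor.\<close>
    have "B i s * c (m - i) (t - s) = 0" if "excess m t < 0"
    proof (cases "?s < 0")
      case True
      then have "int s < int (a * i)" by simp
      then show ?thesis by (simp only: of_nat_less_iff B_less)
    next
      case False
      then show ?thesis using that IH e by simp
    qed
    moreover have "weight (int a) ?e + 2 * (?s div int a) \<le> weight (int a) (excess m t)"
      unfolding e by (rule weight_add_le) (use a in simp)
    then have "h ^ nat (int m - weight (int a) (excess m t)) dvd B i s * c (m - i) (t - s)"
      using le by (intro power_dvd_mult_nat[OF B_dvd conjunct2[OF IH]]) (simp add: of_nat_diff)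
    ultimately show ?thesis by blast
  qed
  have "h ^ nat (int m - weight (int a) (excess m t)) dvd A m t"
    using A_excess(2)[of m t] by (cases "A m t = 0") auto
  moreover have "h ^ nat (int m - weight (int a) (excess m t)) dvd (case p of (i, s) \<Rightarrow> B i s * c (m - i) (t - s))"
    if "p \<in> {..m} \<times> {..t} - {(0, 0)}" for p
    using summand[of "fst p" "snd p"] that by (cases p) auto
  ultimately have "h ^ nat (int m - weight (int a) (excess m t)) dvd c m t"
    unfolding c_eq[of m t] by (intro dvd_diff dvd_sum)
  moreover have "c m t = 0" if "excess m t < 0"
  proof -
    have "A m t = 0" using that A_excess(1)[of m t] by linarith
    moreover have "(case p of (i, s) \<Rightarrow> B i s * c (m - i) (t - s)) = 0"
      if "p \<in> {..m} \<times> {..t} - {(0, 0)}" for p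
      using summand[of "fst p" "snd p"] that \<open>excess m t < 0\<close> by (cases p) auto
    then have "(\<Sum>(i, s) \<in> {..m} \<times> {..t} - {(0, 0)}. B i s * c (m - i) (t - s)) = 0"
      by (intro sum.neutral) blast
    ultimately show ?thesis by (simp add: c_eq[of m t])
  qed
  ultimately show ?case by blast
qed

lemma c_eq_0: "excess m t < 0 \<Longrightarrow> c m t = 0"
  and c_dvd: "h ^ nat (int m - weight (int a) (excess m t)) dvd c m t"
  using c_excess by auto

text \<open>On this line the claimed exponent of h is 0. A term with i > 2u has h in its denominator
  coefficient, and one with i < 2u has h in its quotient coefficient. Balanced terms reduce to x Y^2
  by \<open>B_extremal\<close>.\<close>

lemma c_extremal:
  assumes "weight (int a) (excess m t) = int m"
  shows "[c m t = A m t - (if 2 \<le> m \<and> 3 * a \<le> t then f * c (m - 2) (t - 3 * a) else 0)] (mod h)"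
proof -
  let ?g = "\<lambda>(i, s). B i s * c (m - i) (t - s)"
  let ?I = "{..m} \<times> {..t} - {(0, 0)}"
  have summand: "[?g p = (if p = (2, 3 * a) then f * c (m - 2) (t - 3 * a) else 0)] (mod h)"
    if p: "p \<in> ?I" for p
  proof -
    obtain i s where p_eq: "p = (i, s)" by (cases p)
    then have le: "i \<le> m" "s \<le> t" "(i, s) \<noteq> (0, 0)" using p by auto
    let ?e = "excess (m - i) (t - s)" and ?u = "(int s - int a * int i) div int a"
    have w: "weight (int a) ?e + 2 * ?u \<le> int m"
      unfolding assms [symmetric] excess_split[OF le(1,2)] by (rule weight_add_le) (use a in simp)
    consider "int i = 2 * ?u" | "int i > 2 * ?u" | "int i < 2 * ?u" by linarith
    then show ?thesis
    proof cases
      case 1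
      then show ?thesis using B_extremal[OF 1] le(3) p_eq by auto
    next
      case 2
      have "h dvd B i s"
        by (rule dvd_trans[OF dvd_power B_dvd]) (use 2 in simp)
      moreover have "(i, s) \<noteq> (2, 3 * a)" using 2 a by auto
      ultimately show ?thesis by (auto simp: cong_0_iff p_eq)
    next
      case 3
      have "h dvd c (m - i) (t - s)"
        by (rule dvd_trans[OF dvd_power c_dvd]) (use 3 w le in simp)
      moreover have "(i, s) \<noteq> (2, 3 * a)" using 3 a by auto
      ultimately show ?thesis by (auto simp: cong_0_iff p_eq)
    qed
  qed
  have "[sum ?g ?I = (\<Sum>p\<in>?I. if p = (2, 3 * a) then f * c (m - 2) (t - 3 * a) else 0)] (mod h)"
    by (rule cong_sum) (rule summand)
  also have "(\<Sum>p\<in>?I. if p = (2, 3 * a) then f * c (m - 2) (t - 3 * a) else 0)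
    = (if 2 \<le> m \<and> 3 * a \<le> t then f * c (m - 2) (t - 3 * a) else 0)"
    by (subst sum.delta) auto
  finally show ?thesis unfolding c_eq[of m t] by (intro cong_diff cong_refl)
qed

text \<open>The step from (m, t) to (m + 2, t + 3a) raises the excess by a and the weight by 2, so
  the chain stays on the extremal line. It starts at the numerator coefficient k.\<close>

lemma c_extremal_odd: "[c (2 * u + 1) (3 * a * u + 1) = k * (- f) ^ u] (mod h)"
proof (induction u)
  case 0
  have "weight (int a) (excess 1 1) = int 1"
    using weight_multiple[of "int a" 0] a by (simp add: excess_def)
  from c_extremal[OF this] show ?case by (simp add: A_1(2) [simplified])
next
  case (Suc u)
  let ?m = "2 * Suc u + 1" and ?t = "3 * a * Suc u + 1"
  have "excess ?m ?t = int a * int (Suc u)" by (simp add: excess_def algebra_simps)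
  then have w: "weight (int a) (excess ?m ?t) = int ?m"
    using weight_multiple[of "int a" "int (Suc u)"] a by simp
  \<comment> \<open>A nonzero value would require weight at least 2m - 2, which exceeds m since m >=
    3.\<close>
  have "A ?m ?t = 0" using A_excess(3)[of ?m ?t] unfolding w by auto
  then have "[c ?m ?t = - f * c (2 * u + 1) (3 * a * u + 1)] (mod h)"
    using c_extremal[OF w] by (simp add: algebra_simps)
  also have "[- f * c (2 * u + 1) (3 * a * u + 1) = - f * (k * (- f) ^ u)] (mod h)"
    by (intro cong_mult cong_refl Suc)
  finally show ?case by (simp add: algebra_simps)
qed

text \<open>The same chain, started at the numerator coefficient \<open>f\<close> with excess
  1.\<close>

lemma c_extremal_even: "[c (2 * u + 2) (3 * a * u + a + 2) = f * (- f) ^ u] (mod h)"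
proof (induction u)
  case 0
  have "weight (int a) (excess 2 (a + 2)) = int 2"
    using weight_multiple_add_1[of "int a" 0] a by (simp add: excess_def)
  \<comment> \<open>The recursive term is absent, because a + 2 < 3a.\<close>
  from c_extremal[OF this] show ?case using a A_2 by (simp add: numeral_2_eq_2)
next
  case (Suc u)
  let ?m = "2 * Suc u + 2" and ?t = "3 * a * Suc u + a + 2"
  have "excess ?m ?t = int a * int (Suc u) + 1" by (simp add: excess_def algebra_simps)
  then have w: "weight (int a) (excess ?m ?t) = int ?m"
    using weight_multiple_add_1[of "int a" "int (Suc u)"] a by simp
  have "A ?m ?t = 0" using A_excess(3)[of ?m ?t] unfolding w by auto
  then have "[c ?m ?t = - f * c (2 * u + 2) (3 * a * u + a + 2)] (mod h)"
    using c_extremal[OF w] by (simp add: algebra_simps)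
  also have "[- f * c (2 * u + 2) (3 * a * u + a + 2) = - f * (f * (- f) ^ u)] (mod h)"
    by (intro cong_mult cong_refl Suc)
  finally show ?case by (simp add: algebra_simps)
qed

end

section \<open>The concrete series satisfy the abstract bounds\<close>

text \<open>The first two terms are multiples of q^a. This reads off the leading coefficients in the
  formulas for indices at least 2.\<close>

lemma bracket_nth:
  fixes G1 G2 G3 :: "int fps"
  assumes "t < a"
  shows "fps_nth (fps_X ^ (3 * a) * G1 - (1 + fps_X ^ a) * fps_X ^ a * G2 + G3) t = fps_nth G3 t"
proof -
  have "(1 + fps_X ^ a) * fps_X ^ a * G2 = fps_X ^ a * ((1 + fps_X ^ a) * G2)"
    by (simp add: algebra_simps)
  then show ?thesis
    using assms by (simp only: fps_add_nth fps_sub_nth fps_X_power_mult_nth) simp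
qed

lemma F_tail_nth_0_eq: "fps_nth (F_tail k p) 0 = k * (k - 3) div 2"
  using F_tail_nth_0[of k p] by linarith

lemma graded_quotient_C_series:
  assumes a: "a \<ge> 2"
  shows "graded_quotient a \<bar>k - 1\<bar> k (k * (k - 3) div 2)
    (\<lambda>m t. fps_nth (fps_nth (second_diff (fps_X ^ a) (C_num a k)) m) t)
    (\<lambda>m t. fps_nth (fps_nth (second_diff (fps_X ^ a) (C_den a k)) m) t)
    (\<lambda>m t. fps_nth (C_series a k m) t)"
    (is "graded_quotient _ _ _ _ ?A ?B ?c")
proof
  show "a \<ge> 2" by (rule a)
  fix m t
  \<comment> \<open>Multiplying numerator and denominator by the same factor leaves the quotient
    unchanged.\<close>
  have "second_diff (fps_X ^ a) (C_num a k) = second_diff (fps_X ^ a) (C_den a k) * Abs_fps (C_series a k)"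
    by (simp add: second_diff_def ac_simps flip: C_series_mult_C_den)
  then show "(\<Sum>i\<le>m. \<Sum>s\<le>t. ?B i s * ?c (m - i) (t - s)) = ?A m t"
    by (simp add: fps_mult_nth fps_sum_nth atLeast0AtMost)
next
  show "?B 0 0 = 1" by (rule den_second_diff_0) (use a in simp)
next
  fix s assume "0 < s" "s < a"
  then show "?B 0 s = 0" by (intro den_second_diff_0) auto
next
  fix s assume "s < 2 * a"
  then show "\<bar>k - 1\<bar> dvd ?B 1 s" by (subst den_second_diff_1) auto
next
  fix s assume "s < a"
  then show "?B 1 s = 0" by (subst den_second_diff_1) auto
next
  fix i s assume i: "2 \<le> i" "s < a * (2 * i - 1)"
  then obtain m where m: "i = m + 2" by (metis add.commute le_Suc_ex)
  have "2 * i - 1 = 2 * m + 3" by (simp add: m)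
  then show "?B i s = 0"
    using i a unfolding m by (subst den_second_diff_ge_2) (simp_all only: fps_X_power_mult_nth, auto)
next
  fix s assume s: "3 * a \<le> s" "s < 4 * a"
  \<comment> \<open>At m = 0 the prefactor is q^(3a). In the remaining degrees below a, the tail
    H(q^a) has only its constant term.\<close>
  have "?B (0 + 2) s = fps_nth (fps_X ^ (3 * a) * F_tail k (a * (0 + 3))
      - (1 + fps_X ^ a) * fps_X ^ a * F_tail k (a * (0 + 2)) + F_tail k (a * (0 + 1))) (s - 3 * a)"
    using s a by (subst den_second_diff_ge_2)
      (simp_all add: fps_X_power_mult_nth mult.commute[of a 3] del: fps_add_nth fps_sub_nth)
  also have "\<dots> = fps_nth (F_tail k (a * (0 + 1))) (s - 3 * a)"
    by (rule bracket_nth) (use s in linarith)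
  finally have "?B 2 s = fps_nth (F_tail k a) (s - 3 * a)" by (simp only: add_0 mult_1_right)
  then show "?B 2 s = (if s = 3 * a then k * (k - 3) div 2 else 0)"
    using s F_tail_nth_less[of "s - 3 * a" a] F_tail_nth_0_eq[of k a] by (cases "s = 3 * a") auto
next
  show "?A 1 0 = 0" "?A 1 1 = k" using num_second_diff_1[OF a] by auto
next
  fix m t assume i: "2 \<le> m" "t < a * (2 * m - 3) + 2"
  then obtain n where n: "m = n + 2" by (metis add.commute le_Suc_ex)
  have "2 * m - 3 = 2 * n + 1" by (simp add: n)
  then show "?A m t = 0"
    using i a unfolding n by (subst num_second_diff_ge_2) (simp_all only: fps_X_power_mult_nth, auto)
next
  have idx: "\<not> a + 2 < a * (2 * 0 + 1) + 2" "a + 2 - (a * (2 * 0 + 1) + 2) = 0" by simp_all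
  \<comment> \<open>At m = 0 the prefactor is exactly q^(a+2), so the constant term of the bracket
    is what remains.\<close>
  have "?A (0 + 2) (a + 2) = fps_nth (fps_X ^ (3 * a) * F_tail k (a * (0 + 2) + 1)
      - (1 + fps_X ^ a) * fps_X ^ a * F_tail k (a * (0 + 1) + 1) + F_tail k (a * 0 + 1)) 0"
    using a by (subst num_second_diff_ge_2) (simp, simp only: fps_X_power_mult_nth idx if_False)
  also have "\<dots> = k * (k - 3) div 2"
    using a by (subst bracket_nth) (simp, rule F_tail_nth_0_eq)
  finally show "?A 2 (a + 2) = k * (k - 3) div 2" by (simp only: add_0)
qed

section \<open>Coefficients of W - T in terms of C\<close>

text \<open>Reconciles \<open>T_series\<close>, which substitutes q^a before taking the power, with
  \<open>C_den\<close>, which substitutes afterwards.\<close>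

lemma unit_power_int_compose:
  fixes f g :: "int fps"
  assumes "fps_nth f 0 = 1" "fps_nth g 0 = 0"
  shows "unit_power_int (f oo g) k = unit_power_int f k oo g"
proof -
  have "f * unit_inverse f = 1"
    by (rule fps_mult_unit_inverse[of _ 1]) (simp add: assms)
  then have "(f oo g) * (unit_inverse f oo g) = 1"
    using assms by (simp flip: fps_compose_mult_distrib)
  then have "unit_inverse (f oo g) = unit_inverse f oo g" by (rule unit_inverse_eqI)
  then show ?thesis using assms by (simp add: unit_power_int_def fps_compose_power)
qed

text \<open>Comparing constant terms in X gives F(q) / F(q^a); hence the term j = 0 of W is exactly
  T.\<close>

lemma C_series_0:
  assumes "a > 0"
  shows "C_series a k 0 = unit_power_int Euler_Phi k * unit_inverse (unit_power_int (Euler_Phi oo fps_X ^ a) k)"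
proof -
  let ?D = "unit_power_int (Euler_Phi oo fps_X ^ a) k"
  have D: "?D = F_series k oo fps_X ^ a"
    unfolding F_series_def by (rule unit_power_int_compose) (use assms in \<open>simp_all add: Euler_Phi_nth_0\<close>)
  have "fps_nth (Abs_fps (C_series a k) * C_den a k) 0 = fps_nth (C_num a k) 0"
    by (simp only: C_series_mult_C_den)
  then have "C_series a k 0 * ?D = F_series k"
    by (simp add: C_den_def C_num_def D)
  then have "C_series a k 0 * (?D * unit_inverse ?D) = F_series k * unit_inverse ?D"
    by (simp only: flip: mult.assoc)
  then show ?thesis by (simp only: T_series_den_inverse mult_1_right F_series_def)
qed

text \<open>In the q-adic topology each coefficient of the partial sums is eventually constant, so a
  long enough partial sum gives the value.\<close>

lemma fps_suminf_nth:
  fixes f :: "nat \<Rightarrow> 'a::comm_ring_1 fps"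
  assumes "summable f" "\<And>j. j \<ge> N \<Longrightarrow> fps_nth (f j) n = 0"
  shows "fps_nth (suminf f) n = (\<Sum>j<N. fps_nth (f j) n)"
proof -
  obtain M where M: "\<forall>m\<ge>M. fps_nth (\<Sum>j<m. f j) n = fps_nth (suminf f) n"
    using summable_LIMSEQ[OF assms(1)] unfolding tendsto_fps_iff eventually_sequentially by blast
  have "fps_nth (suminf f) n = (\<Sum>j<max M N. fps_nth (f j) n)"
    using M[rule_format, of "max M N"] by (simp add: fps_sum_nth)
  also have "\<dots> = (\<Sum>j<N. fps_nth (f j) n)"
    using assms(2) by (intro sum.mono_neutral_right) auto
  finally show ?thesis .
qed

text \<open>The term j = 0 cancels against T. Terms with j > n + a - 1 start beyond the degree read,
  because ajd >= j.\<close>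

lemma W_minus_T_nth:
  assumes "a > 0" "d > 0"
  shows "fls_nth (W_series a d k - T_series a k) n =
    (if n + int a < 1 then 0 else \<Sum>j = 1..nat (n + int a - 1).
      if a * j * d \<le> nat (n + int a - 1)
      then fps_nth (C_series a k (j * d)) (nat (n + int a - 1) - a * j * d) else 0)"
proof -
  define S where "S = (\<Sum>j. C_series a k (j * d) * fps_X ^ (a * j * d))"
  have WT: "W_series a d k - T_series a k = fls_X_intpow (1 - int a) * fps_to_fls (S - C_series a k 0)"
    by (simp add: W_series_def T_series_def S_def C_series_0[OF assms(1)] right_diff_distrib)
  define t where "t = nat (n + int a - 1)"
  have "fps_nth S t = (\<Sum>j<Suc t. fps_nth (C_series a k (j * d) * fps_X ^ (a * j * d)) t)"
    unfolding S_def
  proof (rule fps_suminf_nth[OF summable_W_series[OF assms]])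
    fix j assume "j \<ge> Suc t"
    moreover have "j * 1 \<le> j * (a * d)" using assms by (intro mult_le_mono2) (simp add: Suc_le_eq)
    moreover have "j * (a * d) = a * j * d" by (simp only: ac_simps)
    ultimately have "t < a * j * d" by linarith
    then show "fps_nth (C_series a k (j * d) * fps_X ^ (a * j * d)) t = 0"
      by (simp add: fps_X_power_mult_right_nth)
  qed
  also have "\<dots> = (\<Sum>j\<le>t. if a * j * d \<le> t then fps_nth (C_series a k (j * d)) (t - a * j * d) else 0)"
    unfolding lessThan_Suc_atMost by (intro sum.cong) (auto simp: fps_X_power_mult_right_nth)
  also have "\<dots> = fps_nth (C_series a k 0) t
      + (\<Sum>j=1..t. if a * j * d \<le> t then fps_nth (C_series a k (j * d)) (t - a * j * d) else 0)"
    by (subst atMost_atLeast0, subst sum.atLeast_Suc_atMost) auto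
  finally have S: "fps_nth (S - C_series a k 0) t =
    (\<Sum>j=1..t. if a * j * d \<le> t then fps_nth (C_series a k (j * d)) (t - a * j * d) else 0)"
    by simp
  have "fls_nth (W_series a d k - T_series a k) n = fls_nth (fps_to_fls (S - C_series a k 0)) (n + int a - 1)"
    unfolding WT fls_X_intpow_times_conv_shift fls_shift_nth
    by (simp add: algebra_simps del: fps_to_fls_minus)
  also have "\<dots> = (if n + int a < 1 then 0 else fps_nth (S - C_series a k 0) t)"
    by (simp add: t_def del: fps_to_fls_minus fps_sub_nth)
  finally show ?thesis unfolding t_def S[unfolded t_def] .
qed

lemma C_series_nth_eq_0:
  assumes "a \<ge> 2" "int t \<le> int a * (int m - 1)"
  shows "fps_nth (C_series a k m) t = 0"
proof -
  interpret graded_quotient a "\<bar>k - 1\<bar>" k "k * (k - 3) div 2"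
    "\<lambda>m t. fps_nth (fps_nth (second_diff (fps_X ^ a) (C_num a k)) m) t"
    "\<lambda>m t. fps_nth (fps_nth (second_diff (fps_X ^ a) (C_den a k)) m) t"
    "\<lambda>m t. fps_nth (C_series a k m) t"
    by (rule graded_quotient_C_series) fact
  show ?thesis using assms by (intro c_eq_0) (simp add: excess_def)
qed

text \<open>Since C_m starts no earlier than q^(a(m-1)+1), the j-th term of W starts no earlier than
  E_0 + 2ad(j - 1).\<close>

lemma W_minus_T_below:
  assumes "a \<ge> 2" "d \<ge> 2" "n < E_start a d"
  shows "fls_nth (W_series a d k - T_series a k) n = 0"
proof -
  define t where "t = nat (n + int a - 1)"
  have "fps_nth (C_series a k (j * d)) (t - a * j * d) = 0" if "j \<ge> 1" "a * j * d \<le> t" for j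
  proof (rule C_series_nth_eq_0)
    have "1 * (2 * (int a * int d)) \<le> int j * (2 * (int a * int d))"
      using that by (intro mult_right_mono) auto
    moreover have "int t \<le> 2 * int a * int d - int a"
      using assms that unfolding t_def E_start_def
      by (cases "n + int a - 1 \<ge> 0") (auto simp: algebra_simps)
    ultimately show "int (t - a * j * d) \<le> int a * (int (j * d) - 1)"
      using that(2) by (simp add: of_nat_diff algebra_simps)
  qed fact
  then show ?thesis using assms by (subst W_minus_T_nth) (auto simp flip: t_def intro!: sum.neutral)
qed

text \<open>The terms with j >= 2 start at E_0 + 2ad or later, so only j = 1 is seen in this
  range.\<close>

lemma W_minus_T_nth_eq_C_series:
  assumes "a \<ge> 2" "d \<ge> 2" "0 \<le> r" "r < 2 * int a * int d"
  shows "fls_nth (W_series a d k - T_series a k) (E_start a d + r)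
    = fps_nth (C_series a k d) (nat (int a * (int d - 1) + 1 + r))"
proof -
  define t where "t = nat (E_start a d + r + int a - 1)"
  have ad: "int a \<le> int a * int d" using assms by simp
  have E: "E_start a d + r + int a - 1 = 2 * (int a * int d) - int a + 1 + r"
    by (simp add: E_start_def algebra_simps)
  then have t: "int t = 2 * (int a * int d) - int a + 1 + r"
    using ad assms unfolding t_def by linarith
  have "int (a * 1 * d) = int a * int d" by simp
  then have le: "a * 1 * d \<le> t" using t ad assms(3) by linarith
  have "int a * (int d - 1) + 1 + r = int (t - a * 1 * d)"
    using le t by (simp add: of_nat_diff algebra_simps)
  then have eq: "t - a * 1 * d = nat (int a * (int d - 1) + 1 + r)"
    by (simp only: nat_int)
  have neutral: "fps_nth (C_series a k (j * d)) (t - a * j * d) = 0" if "j \<ge> 2" "a * j * d \<le> t" for j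
  proof (rule C_series_nth_eq_0)
    define P N where "P = int a * int d" and "N = int j * P"
    have "int (t - a * j * d) = int t - N"
      using that(2) by (simp add: of_nat_diff N_def P_def)
    moreover have "int a * (int (j * d) - 1) = N - int a"
      by (simp add: right_diff_distrib N_def P_def)
    moreover have "2 * P \<le> N"
      unfolding N_def P_def using that by (intro mult_right_mono) auto
    moreover have "r < 2 * P" "int t = 2 * P - int a + 1 + r" using assms(4) t by (simp_all add: P_def)
    ultimately show "int (t - a * j * d) \<le> int a * (int (j * d) - 1)"
      by simp
  qed fact
  have nonneg: "\<not> E_start a d + r + int a < 1"
    using E ad assms(3) by linarith
  have "fls_nth (W_series a d k - T_series a k) (E_start a d + r) =
    (\<Sum>j = 1..t. if a * j * d \<le> t then fps_nth (C_series a k (j * d)) (t - a * j * d) else 0)"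
    using assms nonneg unfolding t_def by (subst W_minus_T_nth) simp_all
  also have "\<dots> = (\<Sum>j \<in> {1}. if a * j * d \<le> t then fps_nth (C_series a k (j * d)) (t - a * j * d) else 0)"
  proof (rule sum.mono_neutral_right)
    have "1 \<le> a * 1 * d" using assms by simp
    then have "1 \<le> t" using le by (rule order_trans)
    then show "{1} \<subseteq> {1..t}" by simp
  qed (auto intro!: neutral)
  also have "\<dots> = fps_nth (C_series a k d) (nat (int a * (int d - 1) + 1 + r))"
    using le eq by simp
  finally show ?thesis .
qed

section \<open>The residue of b modulo h\<close>

text \<open>With e = k - 1 one has b = 1 - e(e - 1)/2. For odd e the quotient (e - 1)/2 is an
  integer; for e = 2v this reads b = 1 + v - ve.\<close>

lemma b_cong:
  fixes k h b :: int
  assumes h: "h = \<bar>k - 1\<bar>" and b: "b = - ((k * (k - 3)) div 2)"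
  shows "odd h \<Longrightarrow> [b = 1] (mod h)" "even h \<Longrightarrow> [b = 1 + h div 2] (mod h)"
proof -
  define e where "e = k - 1"
  have "k * (k - 3) = e * (e - 1) - 2" by (simp add: e_def algebra_simps)
  then have b_e: "b = 1 - e * (e - 1) div 2" using b by simp
  have h_e: "h = \<bar>e\<bar>" by (simp add: h e_def)
  show "[b = 1] (mod h)" if "odd h"
  proof -
    obtain v where v: "e = 2 * v + 1" using \<open>odd h\<close> h_e by (auto elim: oddE)
    have "b = 1 - e * v" by (simp add: b_e v)
    then show ?thesis by (simp add: cong_iff_dvd_diff h_e)
  qed
  show "[b = 1 + h div 2] (mod h)" if "even h"
  proof -
    obtain v where v: "e = 2 * v" using \<open>even h\<close> h_e by auto
    have "e * (e - 1) = 2 * (v * (e - 1))" by (simp add: v)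
    then have "e * (e - 1) div 2 = v * (e - 1)" by (simp only: nonzero_mult_div_cancel_left)
    then have "b = 1 - v * (e - 1)" by (simp only: b_e)
    moreover have "h div 2 = \<bar>v\<bar>" by (simp add: h_e v abs_mult)
    ultimately have "b - (1 + h div 2) = e * (- v) + (v - \<bar>v\<bar>)" by (simp add: algebra_simps)
    \<comment> \<open>The difference is 0 or 2v = e, so the sign of k - 1 does not affect the
      residue.\<close>
    moreover have "e dvd v - \<bar>v\<bar>" by (auto simp: v abs_if)
    ultimately show ?thesis by (simp add: cong_iff_dvd_diff h_e)
  qed
qed

text \<open>For $h \equiv 2$ modulo 4 the number $b$ is not invertible modulo $h$, but it is modulo $h/2$.\<close>

lemma b_power_not_cong_0:
  fixes k h b :: int
  assumes "h = \<bar>k - 1\<bar>" "b = - ((k * (k - 3)) div 2)" "h \<ge> 3"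
  shows "\<not> [(-1) ^ i * b ^ j = 0] (mod h)"
proof
  assume "[(-1) ^ i * b ^ j = 0] (mod h)"
  then have dvd: "h dvd b ^ j" by (cases "even i") (simp_all add: cong_0_iff)
  define g where "g = (if odd h then h else h div 2)"
  \<comment> \<open>An even h is at least 4 here, so its half is still a proper modulus.\<close>
  have "g \<ge> 2" using assms(3) by (auto simp: g_def elim: evenE)
  have "g dvd h" by (auto simp: g_def elim: evenE)
  have "[b = 1] (mod g)"
  proof (cases "odd h")
    case True
    then show ?thesis using b_cong(1)[OF assms(1,2)] by (simp add: g_def)
  next
    case False
    then have "[b = 1 + h div 2] (mod g)"
      using b_cong(2)[OF assms(1,2)] \<open>g dvd h\<close> cong_dvd_modulus by blast
    then show ?thesis using False by (simp add: g_def cong_def)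
  qed
  then have "[b ^ j = 1] (mod g)" using cong_pow[of b 1 g j] by simp
  moreover have "g dvd b ^ j" using \<open>g dvd h\<close> dvd by (rule dvd_trans)
  ultimately have "g dvd 1" by (simp add: cong_dvd_iff cong_sym)
  then show False using \<open>g \<ge> 2\<close> by simp
qed

section \<open>The endpoint and the final assembly\<close>

text \<open>Removes the halving in \<open>E_end\<close>: the offsets au and au + 1 are the points
  where \<open>weight\<close> first reaches 2u + 1 and 2u + 2, that is, d.\<close>

lemma E_end_cases:
  assumes "a \<ge> 2" "d \<ge> 2"
  obtains (odd) u where "d = 2 * u + 1" "E_end a d - E_start a d = int a * int u"
  | (even) u where "d = 2 * u + 2" "E_end a d - E_start a d = int a * int u + 1"
proof (cases "odd d")
  case True
  then obtain u where u: "d = 2 * u + 1" by (auto elim: oddE)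
  have "5 * int a * (int d - 1) = 2 * (5 * int a * int u)" by (simp add: u)
  then have "5 * int a * (int d - 1) div 2 = 5 * int a * int u"
    by (simp only: nonzero_mult_div_cancel_left)
  then have "E_end a d - E_start a d = int a * int u"
    using True by (simp add: E_end_def E_start_def u)
  then show thesis using u by (rule odd[rotated])
next
  case False
  then obtain v where v: "d = 2 * v" by auto
  define u where "u = v - 1"
  have u: "d = 2 * u + 2" using v assms by (simp add: u_def)
  have "int a * (5 * int d - 6) = 2 * (int a * (5 * int u + 2))" by (simp add: u algebra_simps)
  then have "int a * (5 * int d - 6) div 2 = int a * (5 * int u + 2)"
    by (simp only: nonzero_mult_div_cancel_left)
  then have "E_end a d - E_start a d = int a * int u + 1"
    using False by (simp add: E_end_def E_start_def u algebra_simps)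
  then show thesis using u by (rule even[rotated])
qed

theorem theorem2p12:
  fixes a d :: nat and k h b :: int
  assumes "a \<ge> 2" and "d \<ge> 2"
    and h_def: "h = \<bar>k - 1\<bar>" and "h \<ge> 2"
    and b_def: "b = - ((k * (k - 3)) div 2)"
  shows
    "(\<forall>n < E_start a d. fls_nth (W_series a d k - T_series a k) n = 0)
     \<and> (\<forall>r::int. 0 \<le> r \<and> r \<le> E_end a d - E_start a d \<longrightarrow>
          (let e = int d - 2 - r div int a - (r - 1) div int a
           in e \<ge> 0 \<and> h ^ nat e dvd fls_nth (W_series a d k - T_series a k) (E_start a d + r)))
     \<and> [fls_nth (W_series a d k - T_series a k) (E_end a d) = (-1) ^ (d - 1) * b ^ (d div 2)] (mod h)
     \<and> (h \<ge> 3 \<longrightarrow>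
          \<not> [fls_nth (W_series a d k - T_series a k) (E_end a d) = 0] (mod h)
          \<and> (\<forall>n < E_end a d. [fls_nth (W_series a d k - T_series a k) n = 0] (mod h)))
     \<and> (odd h \<longrightarrow> [b = 1] (mod h))
     \<and> (even h \<longrightarrow> [b = 1 + h div 2] (mod h))"
proof -
  let ?\<Delta> = "\<lambda>n. fls_nth (W_series a d k - T_series a k) n"
  define R where "R = E_end a d - E_start a d"
  interpret graded_quotient a h k "- b"
    "\<lambda>m t. fps_nth (fps_nth (second_diff (fps_X ^ a) (C_num a k)) m) t"
    "\<lambda>m t. fps_nth (fps_nth (second_diff (fps_X ^ a) (C_den a k)) m) t"
    "\<lambda>m t. fps_nth (C_series a k m) t"
    using graded_quotient_C_series[OF \<open>a \<ge> 2\<close>, of k] by (simp add: h_def b_def)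
  have below: "?\<Delta> n = 0" if "n < E_start a d" for n
    using assms(1,2) that by (rule W_minus_T_below)
  \<comment> \<open>The offset R is where the exponent of h first drops to 0: the weight is d at R
    and at most d - 1 just before it.\<close>
  have R_le: "R < 2 * int a * int d" and R_ge: "R \<ge> 0"
    and weight_R: "weight (int a) R = int d" and weight_R1: "weight (int a) (R - 1) \<le> int d - 1"
  proof -
    from assms(1,2) show "R < 2 * int a * int d"
    proof (cases rule: E_end_cases)
      case (odd u)
      have "2 * int a * int d = 2 * int a + 4 * (int a * int u)"
        by (simp add: odd(1) algebra_simps)
      moreover have "0 \<le> int a * int u" by simp
      ultimately show ?thesis using odd(2) assms(1) unfolding R_def by linarith
    next
      case (even u)
      have "2 * int a * int d = 4 * int a + 4 * (int a * int u)"
        by (simp add: even(1) algebra_simps)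
      moreover have "0 \<le> int a * int u" by simp
      ultimately show ?thesis using even(2) assms(1) unfolding R_def by linarith
    qed
    from assms(1,2) show "R \<ge> 0" by (cases rule: E_end_cases) (auto simp: R_def)
    from assms(1,2) show "weight (int a) R = int d"
      by (cases rule: E_end_cases)
        (use assms(1) in \<open>simp_all add: R_def weight_multiple weight_multiple_add_1\<close>)
    from assms(1,2) show "weight (int a) (R - 1) \<le> int d - 1"
      by (cases rule: E_end_cases)
        (use assms(1) in \<open>simp_all add: R_def weight_multiple weight_multiple_minus_1\<close>)
  qed
  have coeff: "?\<Delta> (E_start a d + r) = fps_nth (C_series a k d) (nat (int a * (int d - 1) + 1 + r))"
    if "0 \<le> r" "r \<le> R" for r
    using assms(1,2) that R_le by (intro W_minus_T_nth_eq_C_series) auto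
  have dvd: "h ^ nat (int d - weight (int a) r) dvd ?\<Delta> (E_start a d + r)" if "0 \<le> r" "r \<le> R" for r
  proof -
    have "0 \<le> int a * (int d - 1)" using assms(1,2) by simp
    \<comment> \<open>The offset r from \<open>E_start\<close> is precisely the excess of the
      corresponding coefficient of C_d.\<close>
    then have "excess d (nat (int a * (int d - 1) + 1 + r)) = r"
      using that by (simp add: excess_def)
    then show ?thesis using c_dvd[of d "nat (int a * (int d - 1) + 1 + r)"] coeff[OF that] by simp
  qed
  have "[?\<Delta> (E_start a d + R) = (-1) ^ (d - 1) * b ^ (d div 2)] (mod h)"
    using assms(1,2)
  proof (cases rule: E_end_cases)
    case (odd u)
    have "int a * (int d - 1) + 1 + R = int (3 * a * u + 1)" using odd by (simp add: R_def algebra_simps)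
    then have "?\<Delta> (E_start a d + R) = fps_nth (C_series a k d) (3 * a * u + 1)"
      using coeff[OF R_ge order_refl] by (simp only: nat_int)
    \<comment> \<open>The initial value k of the odd chain is 1 modulo h = |k - 1|.\<close>
    moreover have "[k * b ^ u = 1 * b ^ u] (mod h)"
      by (intro cong_mult cong_refl) (simp add: cong_iff_dvd_diff h_def)
    ultimately show ?thesis using cong_trans[OF c_extremal_odd[of u]] odd(1) by simp
  next
    case (even u)
    have "int a * (int d - 1) + 1 + R = int (3 * a * u + a + 2)" using even by (simp add: R_def algebra_simps)
    then have "?\<Delta> (E_start a d + R) = fps_nth (C_series a k d) (3 * a * u + a + 2)"
      using coeff[OF R_ge order_refl] by (simp only: nat_int)
    then show ?thesis using c_extremal_even[of u] even(1) by simp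
  qed
  then have endpoint: "[?\<Delta> (E_end a d) = (-1) ^ (d - 1) * b ^ (d div 2)] (mod h)"
    by (simp add: R_def)
  have "let e = int d - 2 - r div int a - (r - 1) div int a
      in e \<ge> 0 \<and> h ^ nat e dvd ?\<Delta> (E_start a d + r)" if "0 \<le> r \<and> r \<le> E_end a d - E_start a d" for r
  proof -
    have r: "0 \<le> r" "r \<le> R" using that by (auto simp: R_def)
    have "int d - 2 - r div int a - (r - 1) div int a = int d - weight (int a) r"
      by (simp add: weight_def)
    moreover have "weight (int a) r \<le> int d"
      using weight_mono[of "int a" r R] r assms(1) by (simp add: weight_R)
    ultimately show ?thesis using dvd[OF r] by (simp only: Let_def) simp
  qed
  moreover have "[?\<Delta> n = 0] (mod h)" if "n < E_end a d" for n
  proof (cases "n < E_start a d")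
    case True
    show ?thesis unfolding below[OF True] by (rule cong_refl)
  next
    case False
    define r where "r = n - E_start a d"
    have r: "0 \<le> r" "r \<le> R - 1" using that False by (auto simp: r_def R_def)
    \<comment> \<open>Strictly before the endpoint the exponent is at least 1, by monotonicity of
      \<open>weight\<close>.\<close>
    have "weight (int a) r \<le> int d - 1"
      using order_trans[OF weight_mono[OF _ r(2)] weight_R1] assms(1) by simp
    then have "h dvd h ^ nat (int d - weight (int a) r)" by (intro dvd_power) simp
    also have "\<dots> dvd ?\<Delta> n" using dvd[of r] r by (simp add: r_def)
    finally show ?thesis by (simp add: cong_0_iff)
  qed
  moreover have "\<not> [?\<Delta> (E_end a d) = 0] (mod h)" if "h \<ge> 3"
    using b_power_not_cong_0[OF h_def b_def that] endpoint cong_sym cong_trans by blast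
  ultimately show ?thesis
    using below endpoint b_cong[OF h_def b_def] by blast
qed

end
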